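(* There is an infinite set $K\subset\omega$ such that if $\mathcal{C}=(\omega,R)$ is a computably enumerable equivalence structure such that $\{x: |[x]_R|=k\}$ has asymptotic density zero for any $k$, and if $D$ is a set of asymptotic density one, then $D$ is not a subset of $\{x:|[x]_R|\in K\}$. Thus any equivalence structure $\mathcal{A}$ with character $\chi(\mathcal{A})\subset K\times\{1\}$ cannot be faithfully coarsely computable.
   Context: An equivalence structure $(\omega,R)$ is $\omega$ with an equivalence relation $R$ on it; it is computable (computably enumerable) if $R$ is. $[x]_R$ is the $R$-equivalence class of $x$. A set $S\subseteq\omega$ has asymptotic density $\delta$ if $\lim_{n\to\infty}|S\cap\{0,\dots,n\}|/(n+1)=\delta$. The character of an equivalence structure $\mathcal{A}$ is $\chi(\mathcal{A})=\{(k,n):\mathcal{A}\text{ has at least }n\text{ equivalence classes of size }k\}$, where $k,n$ are positive integers; it gives the number of classes of size $k$ for each finite $k$. For an equivalence relation $R$ on $\omega$, a set $A\subseteq\omega$ is $R$-faithful if for every $R$-class $C$, either $C\subseteq A$ or $C\cap A=\emptyset$. An equivalence structure $(\omega,E)$ is faithfully coarsely computable if there are a computable equivalence relation $R$ on $\omega$ and a set $A$ of asymptotic density one that is both $E$-faithful and $R$-faithful, such that for all $a,b\in A$, $aRb\iff aEb$.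
   Formalization: In the second sentence the structure A is also assumed to have no infinite equivalence classes; without this the claim fails, since the structure with one infinite class is computable and has empty character. *)

theory Defs
  imports Complex_Main
begin

text \<open>
  Partial recursive functions are given by programs and a big-step semantics on argument lists.
  Programs carry no arities: the length of the argument list of every subprogram is determined by
  the length of the argument list at the top, and a call with too few arguments diverges.
\<close>

datatype recf =
    Zero
  | Succ
  | Proj nat
  | Comp recf "recf list"
  | PrimRec recf recf
  | Mu recf

text \<open>In primitive recursion and minimization, the first argument is the active one.\<close>

inductive recf_eval :: "recf \<Rightarrow> nat list \<Rightarrow> nat \<Rightarrow> bool" where
  eval_Zero: "recf_eval Zero xs 0"
| eval_Succ: "recf_eval Succ (x # xs) (Suc x)"
| eval_Proj: "i < length xs \<Longrightarrow> recf_eval (Proj i) xs (xs ! i)"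
| eval_Comp: "list_all2 (\<lambda>g y. recf_eval g xs y) gs ys \<Longrightarrow> recf_eval f ys z
    \<Longrightarrow> recf_eval (Comp f gs) xs z"
| eval_PrimRec_0: "recf_eval f xs z \<Longrightarrow> recf_eval (PrimRec f g) (0 # xs) z"
| eval_PrimRec_Suc: "recf_eval (PrimRec f g) (n # xs) y \<Longrightarrow> recf_eval g (n # y # xs) z
    \<Longrightarrow> recf_eval (PrimRec f g) (Suc n # xs) z"
| eval_Mu: "recf_eval f (n # xs) 0 \<Longrightarrow> (\<forall>m<n. \<exists>y. recf_eval f (m # xs) (Suc y))
    \<Longrightarrow> recf_eval (Mu f) xs n"

inductive_cases recf_eval_ZeroE: "recf_eval Zero xs z"
inductive_cases recf_eval_SuccE: "recf_eval Succ xs z"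
inductive_cases recf_eval_ProjE: "recf_eval (Proj i) xs z"
inductive_cases recf_eval_CompE: "recf_eval (Comp f gs) xs z"
inductive_cases recf_eval_PrimRec_0E: "recf_eval (PrimRec f g) (0 # xs) z"
inductive_cases recf_eval_PrimRec_SucE: "recf_eval (PrimRec f g) (Suc n # xs) z"
inductive_cases recf_eval_MuE: "recf_eval (Mu f) xs z"

lemma recf_eval_deterministic: "recf_eval p xs y \<Longrightarrow> recf_eval p xs z \<Longrightarrow> y = z"
proof (induction arbitrary: z rule: recf_eval.induct)
  case (eval_Zero xs)
  then show ?case by (rule recf_eval_ZeroE) simp
next
  case (eval_Succ x xs)
  then show ?case by (rule recf_eval_SuccE) simp
next
  case (eval_Proj i xs)
  from eval_Proj.prems show ?case by (rule recf_eval_ProjE) simp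
next
  case (eval_Comp xs gs ys f v)
  from eval_Comp.prems obtain ys' where
    ys': "list_all2 (\<lambda>g y. recf_eval g xs y) gs ys'" and f: "recf_eval f ys' z"
    by (rule recf_eval_CompE)
  have "ys = ys'"
  proof (rule nth_equalityI)
    show "length ys = length ys'"
      using eval_Comp.IH(1) ys' by (simp add: list_all2_lengthD[symmetric])
    show "ys ! i = ys' ! i" if "i < length ys" for i
    proof -
      from that have i: "i < length gs" using eval_Comp.IH(1) by (simp add: list_all2_lengthD)
      show ?thesis
        using list_all2_nthD[OF eval_Comp.IH(1) i] list_all2_nthD[OF ys' i] by blast
    qed
  qed
  with f eval_Comp.IH(2) show ?case by blast
next
  case (eval_PrimRec_0 f xs v g)
  from eval_PrimRec_0.prems have "recf_eval f xs z" by (rule recf_eval_PrimRec_0E)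
  then show ?case by (rule eval_PrimRec_0.IH)
next
  case (eval_PrimRec_Suc f g n xs y v)
  from eval_PrimRec_Suc.prems obtain y' where
    y': "recf_eval (PrimRec f g) (n # xs) y'" and z: "recf_eval g (n # y' # xs) z"
    by (rule recf_eval_PrimRec_SucE)
  from y' have "y = y'" by (rule eval_PrimRec_Suc.IH(1))
  with z have "recf_eval g (n # y # xs) z" by simp
  then show ?case by (rule eval_PrimRec_Suc.IH(2))
next
  case (eval_Mu f n xs)
  from eval_Mu.prems have z: "recf_eval f (z # xs) 0"
    and less: "\<forall>m<z. \<exists>y. recf_eval f (m # xs) (Suc y)"
    by (blast elim: recf_eval_MuE)+
  have "\<not> n < z"
  proof
    assume "n < z"
    with less obtain y where "recf_eval f (n # xs) (Suc y)" by blast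
    then have "0 = Suc y" by (rule eval_Mu.IH(1))
    then show False by simp
  qed
  moreover have "\<not> z < n"
  proof
    assume "z < n"
    with eval_Mu.IH(2) obtain y where
      "\<forall>u. recf_eval f (z # xs) u \<longrightarrow> Suc y = u" by blast
    with z show False by blast
  qed
  ultimately show ?case by simp
qed

definition computable_rel :: "(nat \<times> nat) set \<Rightarrow> bool" where
  "computable_rel R \<longleftrightarrow> (\<exists>p. \<forall>x y. recf_eval p [x, y] (if (x, y) \<in> R then 1 else 0))"

text \<open>A relation is computably enumerable if it is the domain of a partial recursive function.\<close>

definition ce_rel :: "(nat \<times> nat) set \<Rightarrow> bool" where
  "ce_rel R \<longleftrightarrow> (\<exists>p. \<forall>x y. (x, y) \<in> R \<longleftrightarrow> (\<exists>z. recf_eval p [x, y] z))"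

definition has_asymptotic_density :: "nat set \<Rightarrow> real \<Rightarrow> bool" where
  "has_asymptotic_density S d \<longleftrightarrow>
     (\<lambda>n. real (card (S \<inter> {0..n})) / real (n + 1)) \<longlonglongrightarrow> d"

text \<open>
  Only finite classes contribute to the character. In particular the structure with a single
  (infinite) class is computable and has empty character, so a hypothesis that bounds the character
  from above says nothing about infinite classes; these have to be excluded separately.
\<close>

definition equiv_character :: "(nat \<times> nat) set \<Rightarrow> (nat \<times> nat) set" where
  "equiv_character R = {(k, n). 0 < k \<and> 0 < n \<and>
     (\<exists>\<C> \<subseteq> UNIV // R. finite \<C> \<and> card \<C> = n \<and> (\<forall>C\<in>\<C>. finite C \<and> card C = k))}"

definition faithful_set :: "(nat \<times> nat) set \<Rightarrow> nat set \<Rightarrow> bool" where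
  "faithful_set R A \<longleftrightarrow> (\<forall>C\<in>UNIV // R. C \<subseteq> A \<or> C \<inter> A = {})"

definition faithfully_coarsely_computable :: "(nat \<times> nat) set \<Rightarrow> bool" where
  "faithfully_coarsely_computable E \<longleftrightarrow>
     (\<exists>R A. equiv UNIV R \<and> computable_rel R \<and> has_asymptotic_density A 1 \<and>
        faithful_set E A \<and> faithful_set R A \<and>
        (\<forall>a\<in>A. \<forall>b\<in>A. (a, b) \<in> R \<longleftrightarrow> (a, b) \<in> E))"

end

theory Submission
  imports Defs "HOL-Library.Countable_Set"
begin

text \<open>
  There are only countably many computably enumerable relations, because there are only countably
  many programs, so \<open>K\<close> can be built by diagonalizing against all of them. Let
  \<open>f\<close> send \<open>x\<close> to the size of its class under one of them, with the
  value 0 for an infinite class, and suppose that every positive value is taken only on a null set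
  (one of density zero). Then every bound \<open>m\<close> admits arbitrarily large
  \<open>n\<close> such that at most half of \<open>{0..n}\<close> has values in
  \<open>{1..m}\<close>. The finitely many numbers in \<open>{0..n}\<close> have a largest value
  \<open>M\<close>, so if \<open>K\<close> consists of positive numbers, none of them in
  \<open>{m<..M}\<close>, then at most half of \<open>{0..n}\<close> has a value in
  \<open>K\<close>. A sufficiently sparse \<open>K\<close> can leave such gaps for all of
  countably many functions, infinitely often for each (lemma \<open>exists_sparse_set\<close>),
  and then no set of density one has all its values in \<open>K\<close>.

  The second half reduces to the first. If a computable \<open>R\<close> agrees with
  \<open>E\<close> on a set \<open>A\<close> that is faithful for both, then the two classes of
  each point of \<open>A\<close> are equal (lemma
  \<open>faithful_sets_have_equal_classes\<close>). So the points of \<open>A\<close> have class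
  sizes in \<open>K\<close> under \<open>R\<close>, which is also computably enumerable. Each size
  belongs to at most one class of \<open>E\<close>, which is finite, and the complement of
  \<open>A\<close> is null; hence \<open>R\<close> meets the density hypothesis, and
  \<open>R\<close> and \<open>A\<close> contradict the first half.
\<close>

section \<open>Asymptotic density\<close>

lemma density_zero_subset:
  assumes "has_asymptotic_density T 0" "S \<subseteq> T"
  shows "has_asymptotic_density S 0"
  unfolding has_asymptotic_density_def
proof (rule tendsto_sandwich[OF _ _ tendsto_const])
  show "(\<lambda>n. real (card (T \<inter> {0..n})) / real (n + 1)) \<longlonglongrightarrow> 0"
    using assms(1) by (simp add: has_asymptotic_density_def)
  have "card (S \<inter> {0..n}) \<le> card (T \<inter> {0..n})" for n
    using assms(2) by (intro card_mono) auto
  then show "\<forall>\<^sub>F n in sequentially. real (card (S \<inter> {0..n})) / real (n + 1)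
      \<le> real (card (T \<inter> {0..n})) / real (n + 1)"
    by (intro always_eventually allI divide_right_mono) auto
qed auto

lemma density_zero_Un:
  assumes "has_asymptotic_density S 0" "has_asymptotic_density T 0"
  shows "has_asymptotic_density (S \<union> T) 0"
  unfolding has_asymptotic_density_def
proof (rule tendsto_sandwich[OF _ _ tendsto_const])
  show "(\<lambda>n. real (card (S \<inter> {0..n})) / real (n + 1) + real (card (T \<inter> {0..n})) / real (n + 1))
      \<longlonglongrightarrow> 0"
    using tendsto_add[OF assms[unfolded has_asymptotic_density_def]] by simp
  have "card ((S \<union> T) \<inter> {0..n}) \<le> card (S \<inter> {0..n}) + card (T \<inter> {0..n})" for n
    by (metis card_Un_le Int_Un_distrib2)
  then have "real (card ((S \<union> T) \<inter> {0..n})) \<le> real (card (S \<inter> {0..n})) + real (card (T \<inter> {0..n}))" for n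
    by (metis of_nat_add of_nat_le_iff)
  then show "\<forall>\<^sub>F n in sequentially. real (card ((S \<union> T) \<inter> {0..n})) / real (n + 1)
      \<le> real (card (S \<inter> {0..n})) / real (n + 1) + real (card (T \<inter> {0..n})) / real (n + 1)"
    unfolding add_divide_distrib[symmetric]
    by (intro always_eventually allI divide_right_mono) auto
qed auto

lemma density_zero_finite:
  assumes "finite S"
  shows "has_asymptotic_density S 0"
  unfolding has_asymptotic_density_def
proof (rule tendsto_sandwich[OF _ _ tendsto_const])
  show "(\<lambda>n. real (card S) / real (n + 1)) \<longlonglongrightarrow> 0"
    using LIMSEQ_ignore_initial_segment[OF lim_const_over_n[of "real (card S)"], of 1] by simp
  have "card (S \<inter> {0..n}) \<le> card S" for n
    using assms by (intro card_mono) auto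
  then show "\<forall>\<^sub>F n in sequentially. real (card (S \<inter> {0..n})) / real (n + 1)
      \<le> real (card S) / real (n + 1)"
    by (intro always_eventually allI divide_right_mono) auto
qed auto

lemma density_zero_UN:
  assumes "finite I" "\<And>i. i \<in> I \<Longrightarrow> has_asymptotic_density (S i) 0"
  shows "has_asymptotic_density (\<Union>i\<in>I. S i) 0"
  using assms
  by (induction I rule: finite_induct) (auto intro: density_zero_Un density_zero_finite)

lemma density_zero_Compl:
  assumes "has_asymptotic_density S 1"
  shows "has_asymptotic_density (- S) 0"
proof -
  have "real (card (- S \<inter> {0..n})) = real (n + 1) - real (card (S \<inter> {0..n}))" for n
  proof -
    have "card {0..n} = card (- S \<inter> {0..n}) + card (S \<inter> {0..n})"
      by (subst card_Un_disjoint[symmetric]) (auto simp flip: Int_Un_distrib2)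
    then show ?thesis by simp
  qed
  then have "real (card (- S \<inter> {0..n})) / real (n + 1) = 1 - real (card (S \<inter> {0..n})) / real (n + 1)" for n
    by (simp add: diff_divide_distrib)
  then show ?thesis
    using tendsto_diff[OF tendsto_const[of "1::real"] assms[unfolded has_asymptotic_density_def]]
    by (simp add: has_asymptotic_density_def)
qed

lemma density_zero_eventually_half:
  assumes "has_asymptotic_density S 0"
  shows "\<forall>\<^sub>F n in sequentially. 2 * card (S \<inter> {0..n}) \<le> n + 1"
proof -
  have "\<forall>\<^sub>F n in sequentially. real (card (S \<inter> {0..n})) / real (n + 1) < 1 / 2"
    using assms unfolding has_asymptotic_density_def by (rule order_tendstoD) simp
  then show ?thesis
    by eventually_elim (auto simp: field_simps)
qed

lemma density_one_eventually_half:
  assumes "has_asymptotic_density S 1"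
  shows "\<forall>\<^sub>F n in sequentially. n + 1 < 2 * card (S \<inter> {0..n})"
proof -
  have "\<forall>\<^sub>F n in sequentially. 1 / 2 < real (card (S \<inter> {0..n})) / real (n + 1)"
    using assms unfolding has_asymptotic_density_def by (rule order_tendstoD) simp
  then show ?thesis
    by eventually_elim (auto simp: field_simps)
qed

section \<open>A sparse set of values\<close>

text \<open>
  The elements \<open>k 0 < k 1 < \<dots>\<close> of \<open>K\<close> are chosen in turn. Step \<open>j\<close> serves one function \<open>f\<close> of the
  family: it first picks \<open>n\<close> such that at most half of \<open>{0..n}\<close> has values in \<open>{1..k j}\<close>, and then
  puts \<open>k (Suc j)\<close> above all values of \<open>f\<close> on \<open>{0..n}\<close>. Every function is served infinitely often,
  since density one is refuted only by unboundedly many \<open>n\<close>.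
\<close>

lemma exists_sparse_set:
  fixes F :: "(nat \<Rightarrow> nat) set"
  assumes "countable F"
    and null: "\<And>f k. f \<in> F \<Longrightarrow> 0 < k \<Longrightarrow> has_asymptotic_density {x. f x = k} 0"
  shows "\<exists>K. infinite K \<and> (\<forall>f\<in>F. \<forall>D. D \<subseteq> {x. f x \<in> K} \<longrightarrow> \<not> has_asymptotic_density D 1)"
proof (cases "F = {}")
  case True
  have "infinite {0::nat<..}" by (rule infinite_Ioi)
  with True show ?thesis by (intro exI[of _ "{0<..}"]) simp
next
  case False
  \<comment> \<open>Decoding pairs repeats each function at infinitely many steps.\<close>
  define g where "g j = from_nat_into F (fst (prod_decode j))" for j
  have gF: "g j \<in> F" for j
    unfolding g_def using False by (rule from_nat_into)
  define gap where "gap j m m' \<longleftrightarrow> m < m' \<and>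
    (\<exists>n\<ge>j. 2 * card ({x. g j x \<in> {1..m}} \<inter> {0..n}) \<le> n + 1 \<and> (\<forall>x\<le>n. g j x < m'))" for j m m'
  have gap_exists: "\<exists>m'. gap j m m'" for j m
  proof -
    have "has_asymptotic_density (\<Union>k\<in>{1..m}. {x. g j x = k}) 0"
      by (intro density_zero_UN null gF) auto
    also have "(\<Union>k\<in>{1..m}. {x. g j x = k}) = {x. g j x \<in> {1..m}}" by auto
    finally obtain N where
      N: "\<And>n. n \<ge> N \<Longrightarrow> 2 * card ({x. g j x \<in> {1..m}} \<inter> {0..n}) \<le> n + 1"
      using density_zero_eventually_half unfolding eventually_sequentially by blast
    define m' where "m' = Suc (Max (insert m (g j ` {..max N j})))"
    have "y < m'" if "y \<in> insert m (g j ` {..max N j})" for y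
      unfolding m'_def using that by (intro le_imp_less_Suc Max_ge) auto
    then have "m < m'" "\<forall>x\<le>max N j. g j x < m'" by auto
    with N[of "max N j"] have "gap j m m'"
      unfolding gap_def by (intro conjI exI[of _ "max N j"]) auto
    then show ?thesis by blast
  qed
  obtain k where k0: "\<And>j. 0 < k j" and kgap: "\<And>j. gap j (k j) (k (Suc j))"
  proof -
    have "\<exists>k. \<forall>j. 0 < k j \<and> gap j (k j) (k (Suc j))"
    proof (rule dependent_nat_choice)
      fix m :: nat and j :: nat
      obtain m' where "gap j m m'" using gap_exists by blast
      moreover from this have "0 < m'" by (auto simp: gap_def)
      ultimately show "\<exists>m'. 0 < m' \<and> gap j m m'" by blast
    qed auto
    then show thesis using that by blast
  qed
  have mono: "strict_mono k"
    using kgap by (simp add: strict_mono_Suc_iff gap_def)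
  have "\<not> has_asymptotic_density D 1" if f: "f \<in> F" and D: "D \<subseteq> {x. f x \<in> range k}" for f D
  proof
    assume "has_asymptotic_density D 1"
    then obtain N where N: "\<And>n. n \<ge> N \<Longrightarrow> n + 1 < 2 * card (D \<inter> {0..n})"
      using density_one_eventually_half unfolding eventually_sequentially by blast
    define j where "j = prod_encode (to_nat_on F f, N)"
    have gj: "g j = f" using assms(1) f by (simp add: g_def j_def)
    have "N \<le> j" unfolding j_def by (rule le_prod_encode_2)
    then obtain n where n: "n \<ge> N" "2 * card ({x. f x \<in> {1..k j}} \<inter> {0..n}) \<le> n + 1"
      and less: "\<And>x. x \<le> n \<Longrightarrow> f x < k (Suc j)"
      using kgap[of j] unfolding gap_def gj by (meson order_trans)
    have "D \<inter> {0..n} \<subseteq> {x. f x \<in> {1..k j}} \<inter> {0..n}"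
    proof
      fix x assume x: "x \<in> D \<inter> {0..n}"
      then obtain i where i: "f x = k i" using D by auto
      with less[of x] x have "i < Suc j" using mono by (simp add: strict_mono_less)
      then have "k i \<le> k j" using mono by (simp add: strict_mono_less_eq)
      with i k0[of i] x show "x \<in> {x. f x \<in> {1..k j}} \<inter> {0..n}" by simp
    qed
    then have "card (D \<inter> {0..n}) \<le> card ({x. f x \<in> {1..k j}} \<inter> {0..n})"
      by (intro card_mono) auto
    with n N[of n] show False by simp
  qed
  moreover have "infinite (range k)"
    using mono by (simp add: range_inj_infinite strict_mono_imp_inj_on)
  ultimately show ?thesis by blast
qed

section \<open>Computably enumerable relations\<close>

instance recf :: countable
  by countable_datatype

lemma countable_ce_rel: "countable {R. ce_rel R}"
proof -
  have "{R. ce_rel R} \<subseteq> range (\<lambda>p. {(x, y). \<exists>z. recf_eval p [x, y] z})"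
    unfolding ce_rel_def by (force simp: set_eq_iff)
  then show ?thesis
    by (rule countable_subset) (rule countableI_type[THEN countable_image])
qed

text \<open>
  If \<open>p\<close> decides \<open>R\<close>, then an unbounded search for a zero of \<open>\<lambda>n. 1 - p x y\<close> halts at once if
  \<open>(x, y) \<in> R\<close> and never otherwise.
\<close>

lemma computable_rel_imp_ce_rel:
  assumes "computable_rel R"
  shows "ce_rel R"
proof -
  obtain p where p: "\<And>x y. recf_eval p [x, y] (if (x, y) \<in> R then 1 else 0)"
    using assms unfolding computable_rel_def by blast
  define flip where "flip = PrimRec (Comp Succ [Zero]) Zero"
  define q where "q = Comp flip [Comp p [Proj 1, Proj 2]]"
  have flip0: "recf_eval flip [0] 1"
    unfolding flip_def
    by (rule eval_PrimRec_0, rule eval_Comp[where ys = "[0]"])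
      (use eval_Succ[of 0] in \<open>auto intro: eval_Zero\<close>)
  have flip1: "recf_eval flip [1] 0"
    using flip0 eval_PrimRec_Suc[of "Comp Succ [Zero]" Zero 0 "[]" 1 0]
    unfolding flip_def by (auto intro: eval_Zero)
  have q: "recf_eval q [n, x, y] (if (x, y) \<in> R then 0 else 1)" for n x y
  proof -
    let ?v = "if (x, y) \<in> R then 1 else 0"
    have "recf_eval (Comp p [Proj 1, Proj 2]) [n, x, y] ?v"
      using eval_Proj[of 1 "[n, x, y]"] eval_Proj[of 2 "[n, x, y]"]
      by (intro eval_Comp[OF _ p]) simp
    moreover have "recf_eval flip [?v] (if (x, y) \<in> R then 0 else 1)"
      using flip0 flip1 by simp
    ultimately show ?thesis
      unfolding q_def by (intro eval_Comp[where ys = "[?v]"]) (simp_all del: One_nat_def)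
  qed
  have "(x, y) \<in> R \<longleftrightarrow> (\<exists>z. recf_eval (Mu q) [x, y] z)" for x y
  proof
    assume "(x, y) \<in> R"
    then have "recf_eval (Mu q) [x, y] 0"
      using q[of 0 x y] by (intro eval_Mu) auto
    then show "\<exists>z. recf_eval (Mu q) [x, y] z" ..
  next
    assume "\<exists>z. recf_eval (Mu q) [x, y] z"
    then obtain n where "recf_eval q [n, x, y] 0" by (auto elim: recf_eval_MuE)
    from recf_eval_deterministic[OF this q] show "(x, y) \<in> R" by (auto split: if_splits)
  qed
  then show ?thesis unfolding ce_rel_def by blast
qed

section \<open>Faithful sets and the character\<close>

lemma faithful_set_class_subset:
  assumes "equiv UNIV E" "faithful_set E A" "a \<in> A"
  shows "E `` {a} \<subseteq> A"
proof -
  have "a \<in> E `` {a}" using equiv_class_self[OF assms(1) UNIV_I] .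
  moreover have "E `` {a} \<in> UNIV // E" by (simp add: quotientI)
  ultimately show ?thesis using assms(2,3) unfolding faithful_set_def by blast
qed

text \<open>Both classes lie inside \<open>A\<close>, where the relations coincide.\<close>

lemma faithful_sets_have_equal_classes:
  assumes "equiv UNIV E" "equiv UNIV R" "faithful_set E A" "faithful_set R A"
    and "\<forall>a\<in>A. \<forall>b\<in>A. (a, b) \<in> R \<longleftrightarrow> (a, b) \<in> E" "a \<in> A"
  shows "R `` {a} = E `` {a}"
  using faithful_set_class_subset[of E A a] faithful_set_class_subset[of R A a] assms by blast

lemma card_class_pos:
  assumes "equiv UNIV E" "finite (E `` {x})"
  shows "0 < card (E `` {x})"
  using assms equiv_class_self[of UNIV E x] by (auto simp: card_gt_0_iff)

lemma card_class_in_character: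
  assumes "equiv UNIV E" "finite (E `` {x})"
  shows "(card (E `` {x}), 1) \<in> equiv_character E"
proof -
  have "{E `` {x}} \<subseteq> UNIV // E" by (simp add: quotientI)
  then show ?thesis
    using assms card_class_pos[OF assms]
    unfolding equiv_character_def by (auto intro!: exI[of _ "{E `` {x}}"])
qed

text \<open>Two distinct classes of the same finite size \<open>k\<close> would put \<open>(k, 2)\<close> into the character.\<close>

lemma equal_card_imp_equal_class:
  assumes E: "equiv UNIV E" and char: "equiv_character E \<subseteq> K \<times> {1}"
    and fin: "finite (E `` {x})" "finite (E `` {y})"
    and eq: "card (E `` {x}) = card (E `` {y})"
  shows "E `` {x} = E `` {y}"
proof (rule ccontr)
  assume neq: "E `` {x} \<noteq> E `` {y}"
  have "{E `` {x}, E `` {y}} \<subseteq> UNIV // E" by (simp add: quotientI)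
  moreover have "card {E `` {x}, E `` {y}} = 2" using neq by simp
  ultimately have "(card (E `` {y}), 2) \<in> equiv_character E"
    using fin eq card_class_pos[OF E fin(2)]
    unfolding equiv_character_def by (auto intro!: exI[of _ "{E `` {x}, E `` {y}}"])
  with char show False by auto
qed

lemma finite_points_with_class_card:
  assumes E: "equiv UNIV E" and fin: "\<forall>C\<in>UNIV // E. finite C"
    and char: "equiv_character E \<subseteq> K \<times> {1}"
  shows "finite {x. card (E `` {x}) = k}"
proof (cases "{x. card (E `` {x}) = k} = {}")
  case False
  have fin': "finite (E `` {x})" for x using fin by (simp add: quotientI)
  from False obtain y where y: "card (E `` {y}) = k" by blast
  have "{x. card (E `` {x}) = k} \<subseteq> E `` {y}"
  proof
    fix x assume "x \<in> {x. card (E `` {x}) = k}"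
    then have "E `` {x} = E `` {y}"
      using equal_card_imp_equal_class[OF E char fin' fin'] y by simp
    then show "x \<in> E `` {y}" using equiv_class_self[OF E, of x] by simp
  qed
  then show ?thesis using fin' by (rule finite_subset)
next
  case True
  then show ?thesis by simp
qed

section \<open>The sparse set defeats all computably enumerable structures\<close>

theorem theorem3p5:
  "\<exists>K :: nat set. infinite K \<and>
     (\<forall>R D. equiv UNIV R \<longrightarrow> ce_rel R \<longrightarrow>
        (\<forall>k. has_asymptotic_density {x. finite (R `` {x}) \<and> card (R `` {x}) = k} 0) \<longrightarrow>
        has_asymptotic_density D 1 \<longrightarrow>
        \<not> D \<subseteq> {x. finite (R `` {x}) \<and> card (R `` {x}) \<in> K}) \<and>
     (\<forall>E. equiv UNIV E \<longrightarrow> (\<forall>C\<in>UNIV // E. finite C) \<longrightarrow>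
        equiv_character E \<subseteq> K \<times> {1} \<longrightarrow>
        \<not> faithfully_coarsely_computable E)"
proof -
  define null_sizes :: "(nat \<times> nat) set \<Rightarrow> bool" where
    "null_sizes R \<longleftrightarrow> (\<forall>k. has_asymptotic_density {x. finite (R `` {x}) \<and> card (R `` {x}) = k} 0)" for R
  define size_fun :: "(nat \<times> nat) set \<Rightarrow> nat \<Rightarrow> nat" where
    "size_fun R x = card (R `` {x})" for R x
  have "countable (size_fun ` {R. ce_rel R \<and> null_sizes R})"
    by (intro countable_image countable_subset[OF _ countable_ce_rel]) auto
  moreover have "has_asymptotic_density {x. f x = k} 0"
    if "f \<in> size_fun ` {R. ce_rel R \<and> null_sizes R}" "0 < k" for f k
  proof -
    from that(1) obtain R where R: "null_sizes R" "f = size_fun R" by auto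
    \<comment> \<open>Infinite classes have cardinality 0, so a positive value belongs to a finite class.\<close>
    have "{x. f x = k} \<subseteq> {x. finite (R `` {x}) \<and> card (R `` {x}) = k}"
      using that(2) R(2) by (auto simp: size_fun_def intro: card_ge_0_finite)
    moreover have "has_asymptotic_density {x. finite (R `` {x}) \<and> card (R `` {x}) = k} 0"
      using R(1) by (simp add: null_sizes_def)
    ultimately show ?thesis by (rule density_zero_subset[rotated])
  qed
  ultimately have "\<exists>K. infinite K \<and> (\<forall>f \<in> size_fun ` {R. ce_rel R \<and> null_sizes R}. \<forall>D.
      D \<subseteq> {x. f x \<in> K} \<longrightarrow> \<not> has_asymptotic_density D 1)"
    by (rule exists_sparse_set)
  then obtain K where "infinite K" and
    sparse: "\<forall>f \<in> size_fun ` {R. ce_rel R \<and> null_sizes R}. \<forall>D.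
      D \<subseteq> {x. f x \<in> K} \<longrightarrow> \<not> has_asymptotic_density D 1"
    by (elim exE conjE)
  have ce: "\<not> D \<subseteq> {x. finite (R `` {x}) \<and> card (R `` {x}) \<in> K}"
    if "ce_rel R" "null_sizes R" "has_asymptotic_density D 1" for R D
  proof
    assume D: "D \<subseteq> {x. finite (R `` {x}) \<and> card (R `` {x}) \<in> K}"
    have "size_fun R \<in> size_fun ` {R. ce_rel R \<and> null_sizes R}"
      using that(1,2) by simp
    moreover have "D \<subseteq> {x. size_fun R x \<in> K}"
      using D by (auto simp: size_fun_def)
    ultimately show False using sparse that(3) by blast
  qed
  have "\<not> faithfully_coarsely_computable E"
    if E: "equiv UNIV E" and fin: "\<forall>C\<in>UNIV // E. finite C"
      and char: "equiv_character E \<subseteq> K \<times> {1}" for E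
  proof
    assume "faithfully_coarsely_computable E"
    then obtain R A where R: "equiv UNIV R" "computable_rel R" and A: "has_asymptotic_density A 1"
      and faithful: "faithful_set E A" "faithful_set R A"
      and agree: "\<forall>a\<in>A. \<forall>b\<in>A. (a, b) \<in> R \<longleftrightarrow> (a, b) \<in> E"
      unfolding faithfully_coarsely_computable_def by blast
    have same: "R `` {a} = E `` {a}" if "a \<in> A" for a
      using faithful_sets_have_equal_classes[OF E R(1) faithful agree that] .
    have "null_sizes R"
      unfolding null_sizes_def
    proof
      fix k
      have "{x. finite (R `` {x}) \<and> card (R `` {x}) = k} \<subseteq> - A \<union> {x. card (E `` {x}) = k}"
        using same by auto
      moreover have "has_asymptotic_density (- A \<union> {x. card (E `` {x}) = k}) 0"
        by (intro density_zero_Un density_zero_Compl A density_zero_finite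
            finite_points_with_class_card[OF E fin char])
      ultimately show "has_asymptotic_density {x. finite (R `` {x}) \<and> card (R `` {x}) = k} 0"
        by (rule density_zero_subset[rotated])
    qed
    moreover have "A \<subseteq> {x. finite (R `` {x}) \<and> card (R `` {x}) \<in> K}"
    proof
      fix a assume "a \<in> A"
      have "finite (E `` {a})" using fin by (simp add: quotientI)
      moreover from this have "card (E `` {a}) \<in> K"
        using card_class_in_character[OF E] char by blast
      ultimately show "a \<in> {x. finite (R `` {x}) \<and> card (R `` {x}) \<in> K}"
        using same[OF \<open>a \<in> A\<close>] by simp
    qed
    ultimately show False
      using ce[OF computable_rel_imp_ce_rel[OF R(2)] _ A] by blast
  qed
  with \<open>infinite K\<close> ce show ?thesis
    unfolding null_sizes_def by (intro exI[of _ K]) blast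
qed

end
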